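(* Let $\mathcal C$ be a connected small category and let $\eta:\mathcal C\to G$ be a nondegenerate cocycle into a discrete group $G$. Let $\psi:\mathcal G(\mathcal C)\to G$ denote the associated cocycle on the fundamental groupoid. The following are equivalent: (i) $\mathcal C\times_\eta G$ is connected; (ii) the cocycle $\psi$ maps $\pi(\mathcal C,x)$ onto $G$ for every $x\in\mathcal C^0$; (iii) the cocycle $\psi$ maps $\pi(\mathcal C,x)$ onto $G$ for some $x\in\mathcal C^0$.
   Context: A small category $\mathcal C$ is identified with its set of morphisms, objects (vertices) being identified with identity morphisms and forming $\mathcal C^0\subseteq\mathcal C$; $r,s$ are range and source, and $\alpha\beta$ is defined iff $s(\alpha)=r(\beta)$; $v\mathcal C w$ is the set of morphisms with range $v$ and source $w$. Categories are assumed nonempty; $\mathcal C$ is connected if the equivalence relation on $\mathcal C^0$ generated by $\{(v,w):v\mathcal C w\neq\varnothing\}$ is all of $\mathcal C^0\times\mathcal C^0$. A cocycle is a functor $\eta:\mathcal C\to G$ into a group; it is nondegenerate if $\eta(\mathcal C)$ generates $G$ as a group. The skew product $\mathcal C\times_\eta G$ is the small category $\mathcal C\times G$ with vertex set $\mathcal C^0\times G$, $s(\alpha,g)=(s(\alpha),g)$, $r(\alpha,g)=(r(\alpha),\eta(\alpha)g)$, and $(\alpha,g)(\beta,h)=(\alpha\beta,h)$ defined if $s(\alpha)=r(\beta)$ and $g=\eta(\beta)h$. The fundamental groupoid of $\mathcal C$ is a pair $(\mathcal G(\mathcal C),i)$, with $i:\mathcal C\to\mathcal G(\mathcal C)$ a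 functor into a groupoid, such that every functor from $\mathcal C$ to a groupoid factors uniquely through $i$ via a groupoid morphism; $i$ maps $\mathcal C^0$ bijectively onto $\mathcal G(\mathcal C)^0$, and these are identified. The associated cocycle $\psi:\mathcal G(\mathcal C)\to G$ is the unique groupoid morphism with $\eta=\psi\circ i$. The fundamental group of $\mathcal C$ at $x\in\mathcal C^0$ is $\pi(\mathcal C,x)=x\,\mathcal G(\mathcal C)\,x$. *)

theory Defs
  imports "HOL-Algebra.Generated_Groups"
begin

section \<open>Small categories\<close>

text \<open>
  A small category is its set of morphisms; an object is identified with its identity
  morphism. The composite \<^term>\<open>cmp C a b\<close> is meaningful only if \<^term>\<open>src C a = rng C b\<close>.
\<close>

record 'a scat =
  Mor :: "'a set"
  src :: "'a \<Rightarrow> 'a"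
  rng :: "'a \<Rightarrow> 'a"
  cmp :: "'a \<Rightarrow> 'a \<Rightarrow> 'a"

locale small_category =
  fixes C :: "'a scat"
  assumes nonempty: "Mor C \<noteq> {}"
    and src_closed: "a \<in> Mor C \<Longrightarrow> src C a \<in> Mor C"
    and rng_closed: "a \<in> Mor C \<Longrightarrow> rng C a \<in> Mor C"
    and src_src: "a \<in> Mor C \<Longrightarrow> src C (src C a) = src C a"
    and rng_src: "a \<in> Mor C \<Longrightarrow> rng C (src C a) = src C a"
    and src_rng: "a \<in> Mor C \<Longrightarrow> src C (rng C a) = rng C a"
    and rng_rng: "a \<in> Mor C \<Longrightarrow> rng C (rng C a) = rng C a"
    and cmp_closed: "\<lbrakk>a \<in> Mor C; b \<in> Mor C; src C a = rng C b\<rbrakk> \<Longrightarrow> cmp C a b \<in> Mor C"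
    and src_cmp: "\<lbrakk>a \<in> Mor C; b \<in> Mor C; src C a = rng C b\<rbrakk> \<Longrightarrow> src C (cmp C a b) = src C b"
    and rng_cmp: "\<lbrakk>a \<in> Mor C; b \<in> Mor C; src C a = rng C b\<rbrakk> \<Longrightarrow> rng C (cmp C a b) = rng C a"
    and cmp_assoc: "\<lbrakk>a \<in> Mor C; b \<in> Mor C; c \<in> Mor C; src C a = rng C b; src C b = rng C c\<rbrakk>
      \<Longrightarrow> cmp C (cmp C a b) c = cmp C a (cmp C b c)"
    and cmp_src: "a \<in> Mor C \<Longrightarrow> cmp C a (src C a) = a"
    and cmp_rng: "a \<in> Mor C \<Longrightarrow> cmp C (rng C a) a = a"

definition Obj :: "'a scat \<Rightarrow> 'a set" where
  "Obj C = {v \<in> Mor C. src C v = v}"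

text \<open>The set \<open>v C w\<close> of morphisms with range \<open>v\<close> and source \<open>w\<close>.\<close>

definition homset :: "'a scat \<Rightarrow> 'a \<Rightarrow> 'a \<Rightarrow> 'a set" where
  "homset C v w = {a \<in> Mor C. rng C a = v \<and> src C a = w}"

text \<open>
  \<^const>\<open>equivclp\<close> is the equivalence closure on the whole type. As the generating relation lives
  on the objects, its restriction to \<^term>\<open>Obj C\<close> is the generated equivalence relation there.
\<close>

definition connected_category :: "'a scat \<Rightarrow> bool" where
  "connected_category C \<longleftrightarrow>
    (\<forall>v \<in> Obj C. \<forall>w \<in> Obj C.
      equivclp (\<lambda>x y. x \<in> Obj C \<and> y \<in> Obj C \<and> homset C x y \<noteq> {}) v w)"

locale groupoid = small_category +
  assumes invertible: "a \<in> Mor C \<Longrightarrow>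
    \<exists>b \<in> Mor C. src C b = rng C a \<and> rng C b = src C a \<and> cmp C a b = rng C a \<and> cmp C b a = src C a"

definition is_functor :: "'a scat \<Rightarrow> 'b scat \<Rightarrow> ('a \<Rightarrow> 'b) \<Rightarrow> bool" where
  "is_functor C D F \<longleftrightarrow>
    (\<forall>a \<in> Mor C. F a \<in> Mor D \<and> F (src C a) = src D (F a) \<and> F (rng C a) = rng D (F a)) \<and>
    (\<forall>a \<in> Mor C. \<forall>b \<in> Mor C. src C a = rng C b \<longrightarrow> F (cmp C a b) = cmp D (F a) (F b))"


section \<open>Cocycles and skew products\<close>

text \<open>A group as a category with one object.\<close>

definition group_cat :: "('g, 'm) monoid_scheme \<Rightarrow> 'g scat" where
  "group_cat G = \<lparr>Mor = carrier G, src = (\<lambda>_. \<one>\<^bsub>G\<^esub>), rng = (\<lambda>_. \<one>\<^bsub>G\<^esub>), cmp = (\<otimes>\<^bsub>G\<^esub>)\<rparr>"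

definition cocycle :: "'a scat \<Rightarrow> ('g, 'm) monoid_scheme \<Rightarrow> ('a \<Rightarrow> 'g) \<Rightarrow> bool" where
  "cocycle C G \<eta> \<longleftrightarrow> is_functor C (group_cat G) \<eta>"

definition nondegenerate :: "'a scat \<Rightarrow> ('g, 'm) monoid_scheme \<Rightarrow> ('a \<Rightarrow> 'g) \<Rightarrow> bool" where
  "nondegenerate C G \<eta> \<longleftrightarrow> generate G (\<eta> ` Mor C) = carrier G"

definition skew_product :: "'a scat \<Rightarrow> ('g, 'm) monoid_scheme \<Rightarrow> ('a \<Rightarrow> 'g) \<Rightarrow> ('a \<times> 'g) scat" where
  "skew_product C G \<eta> =
    \<lparr>Mor = Mor C \<times> carrier G,
     src = (\<lambda>(a, g). (src C a, g)),
     rng = (\<lambda>(a, g). (rng C a, \<eta> a \<otimes>\<^bsub>G\<^esub> g)),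
     cmp = (\<lambda>(a, g) (b, h). (cmp C a b, h))\<rparr>"


section \<open>The fundamental groupoid\<close>

text \<open>
  The universal property with respect to groupoids whose morphisms live in the type \<open>'k\<close>.
  Extensionality expresses that factorisations are compared on the morphisms of \<open>H\<close> only.
\<close>

definition universal_at :: "'k itself \<Rightarrow> 'c scat \<Rightarrow> 'h scat \<Rightarrow> ('c \<Rightarrow> 'h) \<Rightarrow> bool" where
  "universal_at T C H i \<longleftrightarrow>
    (\<forall>(K :: 'k scat) F. groupoid K \<and> is_functor C K F \<longrightarrow>
      (\<exists>!f. f \<in> extensional (Mor H) \<and> is_functor H K f \<and> (\<forall>a \<in> Mor C. f (i a) = F a)))"

text \<open>
  A definition in HOL cannot quantify over all types \<open>'k\<close>. It suffices to test the universal
  property on two of them: the type of \<open>H\<close> itself, and a type large enough to contain a copy of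
  the groupoid of classes of words in the morphisms of \<open>C\<close> and their formal inverses.
  Lemma \<open>fundamental_groupoid_universal\<close> below derives it for groupoids of arbitrary type, and
  \<open>fundamental_groupoid_exists\<close> shows existence.
\<close>

definition fundamental_groupoid :: "'c scat \<Rightarrow> 'h scat \<Rightarrow> ('c \<Rightarrow> 'h) \<Rightarrow> bool" where
  "fundamental_groupoid C H i \<longleftrightarrow>
    groupoid H \<and> is_functor C H i \<and>
    universal_at TYPE('h) C H i \<and>
    universal_at TYPE(('c \<times> bool) list set) C H i"

text \<open>The objects of \<open>C\<close> are identified with those of \<open>H\<close> along \<open>i\<close>.\<close>

definition fundamental_group :: "'h scat \<Rightarrow> ('c \<Rightarrow> 'h) \<Rightarrow> 'c \<Rightarrow> 'h set" where
  "fundamental_group H i x = homset H (i x) (i x)"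

definition associated_cocycle ::
    "'c scat \<Rightarrow> ('g, 'm) monoid_scheme \<Rightarrow> ('c \<Rightarrow> 'g) \<Rightarrow> 'h scat \<Rightarrow> ('c \<Rightarrow> 'h) \<Rightarrow> ('h \<Rightarrow> 'g) \<Rightarrow> bool" where
  "associated_cocycle C G \<eta> H i \<psi> \<longleftrightarrow> cocycle H G \<psi> \<and> (\<forall>a \<in> Mor C. \<eta> a = \<psi> (i a))"

section \<open>The universal property holds for groupoids of every type\<close>

definition ginv :: "'a scat \<Rightarrow> 'a \<Rightarrow> 'a" where
  "ginv K a = (SOME b. b \<in> Mor K \<and> src K b = rng K a \<and> rng K b = src K a \<and>
    cmp K a b = rng K a \<and> cmp K b a = src K a)"

context groupoid
begin

lemma ginv:
  assumes "a \<in> Mor C"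
  shows "ginv C a \<in> Mor C" "src C (ginv C a) = rng C a" "rng C (ginv C a) = src C a"
    "cmp C a (ginv C a) = rng C a" "cmp C (ginv C a) a = src C a"
proof -
  have "\<exists>b. b \<in> Mor C \<and> src C b = rng C a \<and> rng C b = src C a \<and>
      cmp C a b = rng C a \<and> cmp C b a = src C a"
    using invertible[OF assms] by blast
  from someI_ex[OF this]
  show "ginv C a \<in> Mor C" "src C (ginv C a) = rng C a" "rng C (ginv C a) = src C a"
    "cmp C a (ginv C a) = rng C a" "cmp C (ginv C a) a = src C a"
    unfolding ginv_def by auto
qed

lemma inv_unique:
  assumes "a \<in> Mor C" "b \<in> Mor C" "src C b = rng C a" "rng C b = src C a" "cmp C b a = src C a"
  shows "b = ginv C a"
proof -
  have "b = cmp C b (cmp C a (ginv C a))"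
    using assms ginv[OF assms(1)] cmp_src[OF assms(2)] by simp
  also have "\<dots> = cmp C (cmp C b a) (ginv C a)"
    using assms ginv[OF assms(1)] cmp_assoc[of b a "ginv C a"] by simp
  also have "\<dots> = ginv C a"
    using assms ginv[OF assms(1)] cmp_rng[of "ginv C a"] by simp
  finally show ?thesis .
qed

end

lemma functor_ginv:
  assumes "groupoid H" "groupoid K" "is_functor H K f" "a \<in> Mor H"
  shows "f (ginv H a) = ginv K (f a)"
proof -
  interpret H: groupoid H by fact
  interpret K: groupoid K by fact
  note g = H.ginv[OF assms(4)]
  show ?thesis
  proof (rule K.inv_unique)
    have "cmp K (f (ginv H a)) (f a) = f (cmp H (ginv H a) a)"
      using assms(3,4) g unfolding is_functor_def by metis
    also have "\<dots> = src K (f a)"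
      unfolding g(5) using assms(3,4) by (simp add: is_functor_def)
    finally show "cmp K (f (ginv H a)) (f a) = src K (f a)" .
    have "f (src H (ginv H a)) = src K (f (ginv H a))" "f (rng H (ginv H a)) = rng K (f (ginv H a))"
      using assms(3) g unfolding is_functor_def by blast+
    thus "src K (f (ginv H a)) = rng K (f a)" "rng K (f (ginv H a)) = src K (f a)"
      using assms(3,4) g unfolding is_functor_def by auto
  qed (use assms(3,4) g in \<open>auto simp: is_functor_def\<close>)
qed

lemma is_functor_comp:
  "is_functor A B f \<Longrightarrow> is_functor B D g \<Longrightarrow> is_functor A D (\<lambda>x. g (f x))"
  unfolding is_functor_def by metis

text \<open>
  In a word, the letter \<open>(a, True)\<close> stands for \<open>a\<close> and \<open>(a, False)\<close> for its formal inverse.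
\<close>

definition lrng :: "'a scat \<Rightarrow> 'a \<times> bool \<Rightarrow> 'a" where
  "lrng C l = (if snd l then rng C (fst l) else src C (fst l))"

definition lsrc :: "'a scat \<Rightarrow> 'a \<times> bool \<Rightarrow> 'a" where
  "lsrc C l = (if snd l then src C (fst l) else rng C (fst l))"

fun word :: "'a scat \<Rightarrow> ('a \<times> bool) list \<Rightarrow> bool" where
  "word C [] = False"
| "word C [l] = (fst l \<in> Mor C)"
| "word C (l # m # p) = (fst l \<in> Mor C \<and> lsrc C l = lrng C m \<and> word C (m # p))"

definition wrng :: "'a scat \<Rightarrow> ('a \<times> bool) list \<Rightarrow> 'a" where
  "wrng C p = lrng C (hd p)"

definition wsrc :: "'a scat \<Rightarrow> ('a \<times> bool) list \<Rightarrow> 'a" where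
  "wsrc C p = lsrc C (last p)"

lemma word_Cons: "word C (l # p) \<longleftrightarrow> fst l \<in> Mor C \<and> (p = [] \<or> (lsrc C l = wrng C p \<and> word C p))"
  by (cases p) (auto simp: wrng_def)

lemma word_append:
  "p \<noteq> [] \<Longrightarrow> q \<noteq> [] \<Longrightarrow> word C (p @ q) \<longleftrightarrow> word C p \<and> word C q \<and> wsrc C p = wrng C q"
proof (induction p)
  case (Cons l p)
  show ?case
  proof (cases "p = []")
    case True
    thus ?thesis using Cons.prems by (auto simp: word_Cons wsrc_def)
  next
    case False
    thus ?thesis using Cons by (auto simp: word_Cons wsrc_def wrng_def)
  qed
qed simp

lemma wrng_append [simp]: "p \<noteq> [] \<Longrightarrow> wrng C (p @ q) = wrng C p"
  by (simp add: wrng_def)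

lemma wsrc_append [simp]: "q \<noteq> [] \<Longrightarrow> wsrc C (p @ q) = wsrc C q"
  by (simp add: wsrc_def)

lemma word_nonempty: "word C p \<Longrightarrow> p \<noteq> []"
  by (cases p) auto

lemma word_appendI:
  assumes "word C p" "word C q" "wsrc C p = wrng C q"
  shows "word C (p @ q) \<and> wrng C (p @ q) = wrng C p \<and> wsrc C (p @ q) = wsrc C q"
  using assms word_nonempty[OF assms(1)] word_nonempty[OF assms(2)] by (simp add: word_append)

lemma word_replace:
  assumes "word C p \<and> word C q \<and> wrng C q = wrng C p \<and> wsrc C q = wsrc C p"
  shows "word C (u @ p @ v) \<longleftrightarrow> word C (u @ q @ v)"
proof -
  have "p \<noteq> []" "q \<noteq> []" using assms word_nonempty by blast+
  thus ?thesis using assms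
    by (cases "u = []"; cases "v = []") (auto simp: word_append)
qed

inductive wstep :: "'a scat \<Rightarrow> ('a \<times> bool) list \<Rightarrow> ('a \<times> bool) list \<Rightarrow> bool" for C where
  "\<lbrakk>a \<in> Mor C; b \<in> Mor C; src C a = rng C b\<rbrakk> \<Longrightarrow> wstep C [(a, True), (b, True)] [(cmp C a b, True)]"
| "a \<in> Mor C \<Longrightarrow> wstep C [(a, False), (a, True)] [(src C a, True)]"
| "a \<in> Mor C \<Longrightarrow> wstep C [(a, True), (a, False)] [(rng C a, True)]"
| "a \<in> Mor C \<Longrightarrow> wstep C [(src C a, True), (a, False)] [(a, False)]"
| "a \<in> Mor C \<Longrightarrow> wstep C [(a, False), (rng C a, True)] [(a, False)]"

inductive weq :: "'a scat \<Rightarrow> ('a \<times> bool) list \<Rightarrow> ('a \<times> bool) list \<Rightarrow> bool" for C where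
  weq_refl: "word C p \<Longrightarrow> weq C p p"
| weq_sym: "weq C p q \<Longrightarrow> weq C q p"
| weq_trans: "weq C p q \<Longrightarrow> weq C q r \<Longrightarrow> weq C p r"
| weq_step: "wstep C p q \<Longrightarrow> word C (u @ p @ v) \<Longrightarrow> weq C (u @ p @ v) (u @ q @ v)"

declare weq_trans [trans]

definition wcls :: "'a scat \<Rightarrow> ('a \<times> bool) list \<Rightarrow> ('a \<times> bool) list set" where
  "wcls C p = {q. weq C p q}"

definition winv :: "('a \<times> bool) list \<Rightarrow> ('a \<times> bool) list" where
  "winv p = rev (map (\<lambda>(a, b). (a, \<not> b)) p)"

definition rep :: "'b set \<Rightarrow> 'b" where
  "rep X = (SOME p. p \<in> X)"

definition word_groupoid :: "'a scat \<Rightarrow> ('a \<times> bool) list set scat" where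
  "word_groupoid C =
    \<lparr>Mor = wcls C ` {p. word C p},
     src = (\<lambda>X. wcls C [(wsrc C (rep X), True)]),
     rng = (\<lambda>X. wcls C [(wrng C (rep X), True)]),
     cmp = (\<lambda>X Y. wcls C (rep X @ rep Y))\<rparr>"

definition word_incl :: "'a scat \<Rightarrow> 'a \<Rightarrow> ('a \<times> bool) list set" where
  "word_incl C a = wcls C [(a, True)]"

definition letter_ev :: "'k scat \<Rightarrow> ('a \<Rightarrow> 'k) \<Rightarrow> 'a \<times> bool \<Rightarrow> 'k" where
  "letter_ev K F l = (if snd l then F (fst l) else ginv K (F (fst l)))"

fun word_ev :: "'k scat \<Rightarrow> ('a \<Rightarrow> 'k) \<Rightarrow> ('a \<times> bool) list \<Rightarrow> 'k" where
  "word_ev K F [] = undefined"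
| "word_ev K F [l] = letter_ev K F l"
| "word_ev K F (l # m # p) = cmp K (letter_ev K F l) (word_ev K F (m # p))"

lemma word_ev_Cons: "p \<noteq> [] \<Longrightarrow> word_ev K F (l # p) = cmp K (letter_ev K F l) (word_ev K F p)"
  by (cases p) auto

context small_category
begin

lemma lrng_closed: "fst l \<in> Mor C \<Longrightarrow> lrng C l \<in> Mor C"
  by (simp add: lrng_def src_closed rng_closed)

lemma lsrc_closed: "fst l \<in> Mor C \<Longrightarrow> lsrc C l \<in> Mor C"
  by (simp add: lsrc_def src_closed rng_closed)

lemma wrng_closed: "word C p \<Longrightarrow> wrng C p \<in> Mor C"
  by (cases p) (auto simp: word_Cons wrng_def lrng_closed)

lemma wsrc_closed: "word C p \<Longrightarrow> wsrc C p \<in> Mor C"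
proof (induction p)
  case (Cons l p)
  thus ?case by (cases "p = []") (auto simp: word_Cons wsrc_def lsrc_closed)
qed simp

lemma src_wrng: "word C p \<Longrightarrow> src C (wrng C p) = wrng C p \<and> rng C (wrng C p) = wrng C p"
  by (cases p) (auto simp: word_Cons wrng_def lrng_def src_src rng_src src_rng rng_rng)

lemma src_wsrc: "word C p \<Longrightarrow> src C (wsrc C p) = wsrc C p \<and> rng C (wsrc C p) = wsrc C p"
proof (induction p)
  case (Cons l p)
  thus ?case
    by (cases "p = []") (auto simp: word_Cons wsrc_def lsrc_def src_src rng_src src_rng rng_rng)
qed simp

lemma wstep_word:
  assumes "wstep C p q"
  shows "word C p \<and> word C q \<and> wrng C q = wrng C p \<and> wsrc C q = wsrc C p"
  using assms
  by cases (auto simp: wrng_def wsrc_def lrng_def lsrc_def src_closed rng_closed cmp_closed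
      src_cmp rng_cmp src_src rng_src src_rng rng_rng)

lemma weq_word:
  "weq C p q \<Longrightarrow> word C p \<and> word C q \<and> wrng C q = wrng C p \<and> wsrc C q = wsrc C p"
proof (induction rule: weq.induct)
  case (weq_step p q u v)
  have s: "word C p" "word C q" "wrng C q = wrng C p" "wsrc C q = wsrc C p"
    using wstep_word[OF weq_step(1)] by auto
  note ne = word_nonempty[OF s(1)] word_nonempty[OF s(2)]
  show ?case using weq_step(2) s ne
    by (cases "u = []"; cases "v = []") (auto simp: word_append)
qed auto

lemma weq_context:
  "weq C p q \<Longrightarrow> word C (u @ p @ v) \<Longrightarrow> weq C (u @ p @ v) (u @ q @ v)"
proof (induction rule: weq.induct)
  case (weq_sym p q)
  have "word C (u @ p @ v)"
    using weq_word[OF weq_sym(1)] weq_sym(3) word_replace by blast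
  thus ?case using weq_sym by (auto intro: weq.weq_sym)
next
  case (weq_trans p q r)
  have "word C (u @ q @ v)"
    using weq_word[OF weq_trans(1)] weq_trans(5) word_replace by blast
  thus ?case using weq_trans by (auto intro: weq.weq_trans)
next
  case (weq_step p q u' v')
  thus ?case using weq.weq_step[of C p q "u @ u'" "v' @ v"] by simp
qed (auto intro: weq_refl)

lemma wcls_eq: "word C p \<Longrightarrow> wcls C p = wcls C q \<longleftrightarrow> weq C p q"
  unfolding wcls_def by (blast intro: weq_refl weq_sym weq_trans)

lemma rep_wcls: "word C p \<Longrightarrow> weq C p (rep (wcls C p))"
  unfolding rep_def wcls_def by (rule someI2[of _ p]) (auto intro: weq_refl)

lemma wrng_rep [simp]: "word C p \<Longrightarrow> wrng C (rep (wcls C p)) = wrng C p"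
  using weq_word[OF rep_wcls] by blast

lemma wsrc_rep [simp]: "word C p \<Longrightarrow> wsrc C (rep (wcls C p)) = wsrc C p"
  using weq_word[OF rep_wcls] by blast

lemma weq_append:
  assumes "weq C p p'" "weq C q q'" "wsrc C p = wrng C q"
  shows "weq C (p @ q) (p' @ q')"
proof -
  note a = weq_word[OF assms(1)] weq_word[OF assms(2)]
  have w: "word C (p @ q)" "word C (p' @ q)"
    using a assms(3) by (auto simp: word_append word_nonempty)
  have "weq C (p @ q) (p' @ q)" using weq_context[OF assms(1), of "[]" q] w by simp
  moreover have "weq C (p' @ q) (p' @ q')" using weq_context[OF assms(2), of p' "[]"] w by simp
  ultimately show ?thesis by (rule weq_trans)
qed

lemma wcls_rep_append:
  assumes "word C p" "word C q" "wsrc C p = wrng C q"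
  shows "wcls C (rep (wcls C p) @ rep (wcls C q)) = wcls C (p @ q)"
proof -
  have "weq C (p @ q) (rep (wcls C p) @ rep (wcls C q))"
    using assms by (intro weq_append rep_wcls)
  thus ?thesis using weq_word wcls_eq by metis
qed

lemma weq_unit_left: assumes "word C p" shows "weq C ((wrng C p, True) # p) p"
proof (cases p)
  case (Cons l q)
  obtain a b where l: "l = (a, b)" by fastforce
  have a: "a \<in> Mor C" using assms Cons l by (simp add: word_Cons)
  have "wstep C [(wrng C p, True), l] [l]"
  proof (cases b)
    case True
    have "wstep C [(rng C a, True), (a, True)] [(cmp C (rng C a) a, True)]"
      using a by (intro wstep.intros) (auto simp: rng_closed src_rng)
    thus ?thesis using True Cons l a by (simp add: wrng_def lrng_def cmp_rng)
  next
    case False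
    thus ?thesis using Cons l a wstep.intros(4)[OF a] by (simp add: wrng_def lrng_def)
  qed
  moreover have "word C ((wrng C p, True) # p)"
    using assms by (simp add: word_Cons[of C _ p] wrng_closed lsrc_def src_wrng)
  ultimately show ?thesis using weq_step[of C "[(wrng C p, True), l]" "[l]" "[]" q] Cons by simp
qed (use assms in simp)

lemma weq_unit_right: assumes "word C p" shows "weq C (p @ [(wsrc C p, True)]) p"
proof (cases p rule: rev_cases)
  case (snoc q l)
  obtain a b where l: "l = (a, b)" by fastforce
  have a: "a \<in> Mor C" using assms snoc l by (cases "q = []") (auto simp: word_append)
  have "wstep C [l, (wsrc C p, True)] [l]"
  proof (cases b)
    case True
    have "wstep C [(a, True), (src C a, True)] [(cmp C a (src C a), True)]"
      using a by (intro wstep.intros) (auto simp: src_closed rng_src)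
    thus ?thesis using True snoc l a by (simp add: wsrc_def lsrc_def cmp_src)
  next
    case False
    thus ?thesis using snoc l a wstep.intros(5)[OF a] by (simp add: wsrc_def lsrc_def)
  qed
  moreover have "word C (p @ [(wsrc C p, True)])"
    using assms word_nonempty[OF assms]
    by (simp add: word_append wsrc_closed lrng_def src_wsrc wrng_def)
  ultimately show ?thesis using weq_step[of C "[l, (wsrc C p, True)]" "[l]" q "[]"] snoc by simp
qed (use assms in simp)

lemma winv_word: "word C p \<Longrightarrow> word C (winv p) \<and> wrng C (winv p) = wsrc C p \<and> wsrc C (winv p) = wrng C p"
proof (induction p)
  case (Cons l p)
  obtain a b where l: "l = (a, b)" by fastforce
  have *: "winv (l # p) = winv p @ [(a, \<not> b)]" by (simp add: winv_def l)
  show ?case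
  proof (cases "p = []")
    case True
    thus ?thesis using Cons.prems l by (auto simp: winv_def wrng_def wsrc_def lrng_def lsrc_def)
  next
    case False
    hence "winv p \<noteq> []" by (simp add: winv_def)
    moreover have "wrng C [(a, \<not> b)] = lsrc C l" "wsrc C [(a, \<not> b)] = lrng C l"
      by (auto simp: l wrng_def wsrc_def lrng_def lsrc_def)
    ultimately show ?thesis using Cons False l unfolding *
      by (auto simp: word_append word_Cons wrng_def[of _ "_ # _"]) (auto simp: wsrc_def)
  qed
qed simp

lemma winv_winv [simp]: "winv (winv p) = p"
  by (simp add: winv_def rev_map comp_def case_prod_unfold)

lemma weq_winv: "word C p \<Longrightarrow> weq C (p @ winv p) [(wrng C p, True)]"
proof (induction p)
  case (Cons l p)
  obtain a b where l: "l = (a, b)" by fastforce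
  let ?m = "(a, \<not> b)"
  have inv: "winv (l # p) = winv p @ [?m]" by (simp add: winv_def l)
  have a: "a \<in> Mor C" using Cons.prems l by (simp add: word_Cons)
  have "wstep C [l, ?m] [(lrng C l, True)]"
    using a wstep.intros(2,3)[OF a] by (cases b) (auto simp: l lrng_def)
  moreover have lm: "word C [l, ?m]" using a by (auto simp: l lsrc_def lrng_def)
  ultimately have lmeq: "weq C [l, ?m] [(lrng C l, True)]"
    using weq_step[of C _ _ "[]" "[]"] by simp
  show ?case
  proof (cases "p = []")
    case True
    thus ?thesis using lmeq by (simp add: winv_def wrng_def l)
  next
    case False
    hence p: "word C p" "lsrc C l = wrng C p" using Cons.prems by (auto simp: word_Cons)
    have iv: "word C (winv (l # p))" "wrng C (winv (l # p)) = wsrc C (l # p)"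
      using winv_word[OF Cons.prems] by auto
    have w: "word C ([l] @ (p @ winv p) @ [?m])"
      using Cons.prems iv word_append[of "l # p" "winv (l # p)" C] by (simp add: inv)
    have "weq C ([l] @ (p @ winv p) @ [?m]) ([l] @ [(wrng C p, True)] @ [?m])"
      by (rule weq_context[OF Cons.IH[OF p(1)] w])
    also have "weq C ([l] @ [(wrng C p, True)] @ [?m]) [l, ?m]"
    proof -
      have "weq C [(wrng C p, True), ?m] [?m]"
      proof -
        have "wrng C p = wrng C [?m]"
          using p(2)[symmetric] by (simp add: l lsrc_def lrng_def wrng_def[of C "[_]"])
        thus ?thesis using weq_unit_left[of "[?m]"] a by simp
      qed
      moreover have "word C ([l] @ [(wrng C p, True), ?m] @ [])"
        using word_replace[OF weq_word[OF calculation], of "[l]" "[]"] lm by simp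
      ultimately show ?thesis using weq_context[of "[(wrng C p, True), ?m]" "[?m]" "[l]" "[]"] by simp
    qed
    also note lmeq
    finally show ?thesis by (simp add: inv wrng_def)
  qed
qed simp

end

lemma word_groupoid_simps:
  assumes "small_category C"
  shows "X \<in> Mor (word_groupoid C) \<longleftrightarrow> (\<exists>p. word C p \<and> X = wcls C p)"
    and "word C p \<Longrightarrow> src (word_groupoid C) (wcls C p) = wcls C [(wsrc C p, True)]"
    and "word C p \<Longrightarrow> rng (word_groupoid C) (wcls C p) = wcls C [(wrng C p, True)]"
    and "\<lbrakk>word C p; word C q; wsrc C p = wrng C q\<rbrakk> \<Longrightarrow>
      cmp (word_groupoid C) (wcls C p) (wcls C q) = wcls C (p @ q)"
  using small_category.wsrc_rep[OF assms] small_category.wrng_rep[OF assms]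
    small_category.wcls_rep_append[OF assms]
  by (auto simp: word_groupoid_def)

lemma (in small_category) src_rng_word_groupoid:
  assumes "word C p" "word C q"
  shows "src (word_groupoid C) (wcls C p) = rng (word_groupoid C) (wcls C q) \<longleftrightarrow> wsrc C p = wrng C q"
proof
  assume "src (word_groupoid C) (wcls C p) = rng (word_groupoid C) (wcls C q)"
  hence "weq C [(wsrc C p, True)] [(wrng C q, True)]"
    using assms by (simp add: word_groupoid_simps[OF small_category_axioms] wcls_eq wsrc_closed)
  from weq_word[OF this] show "wsrc C p = wrng C q"
    using src_wrng[OF assms(2)] src_wsrc[OF assms(1)] by (simp add: wrng_def lrng_def)
qed (use assms in \<open>simp add: word_groupoid_simps[OF small_category_axioms]\<close>)

lemma (in small_category) word_obj:
  assumes "v \<in> Mor C" "src C v = v"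
  shows "word C [(v, True)]" "wrng C [(v, True)] = v" "wsrc C [(v, True)] = v"
  using assms rng_src[OF assms(1)] by (auto simp: wrng_def wsrc_def lrng_def lsrc_def)

lemma groupoid_word_groupoid:
  assumes "small_category C"
  shows "groupoid (word_groupoid C)"
proof -
  interpret small_category C by fact
  let ?W = "word_groupoid C"
  note S = word_groupoid_simps[OF assms]
  have mem: "wcls C p \<in> Mor ?W" if "word C p" for p
    using that S(1) by blast
  have ws: "word C [(wsrc C p, True)] \<and> wrng C [(wsrc C p, True)] = wsrc C p \<and>
      wsrc C [(wsrc C p, True)] = wsrc C p" if "word C p" for p
    using word_obj wsrc_closed[OF that] src_wsrc[OF that] by blast
  have wr: "word C [(wrng C p, True)] \<and> wrng C [(wrng C p, True)] = wrng C p \<and>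
      wsrc C [(wrng C p, True)] = wrng C p" if "word C p" for p
    using word_obj wrng_closed[OF that] src_wrng[OF that] by blast
  have app: "word C (p @ q) \<and> wrng C (p @ q) = wrng C p \<and> wsrc C (p @ q) = wsrc C q"
    if "word C p" "word C q" "wsrc C p = wrng C q" for p q
    using word_appendI[OF that] .
  show ?thesis
  proof (unfold_locales, goal_cases)
    case 1
    obtain a where "a \<in> Mor C" using nonempty by blast
    hence "word C [(a, True)]" by simp
    thus ?case using S(1) by blast
  next
    case (2 a)
    then obtain p where "word C p" "a = wcls C p" using S(1) by metis
    thus ?case using ws mem S(2) by metis
  next
    case (3 a)
    then obtain p where "word C p" "a = wcls C p" using S(1) by metis
    thus ?case using wr mem S(3) by metis
  next
    case (4 a)
    then obtain p where "word C p" "a = wcls C p" using S(1) by metis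
    thus ?case using ws S(2) by simp
  next
    case (5 a)
    then obtain p where "word C p" "a = wcls C p" using S(1) by metis
    thus ?case using ws S(2,3) by simp
  next
    case (6 a)
    then obtain p where "word C p" "a = wcls C p" using S(1) by metis
    thus ?case using wr S(2,3) by simp
  next
    case (7 a)
    then obtain p where "word C p" "a = wcls C p" using S(1) by metis
    thus ?case using wr S(3) by simp
  next
    case (8 a b)
    then obtain p q where pq: "word C p" "word C q" "a = wcls C p" "b = wcls C q"
      using S(1) by metis
    hence "wsrc C p = wrng C q" using 8 src_rng_word_groupoid by simp
    with pq show ?case using app mem S(4) by simp
  next
    case (9 a b)
    then obtain p q where pq: "word C p" "word C q" "a = wcls C p" "b = wcls C q"
      using S(1) by metis
    hence "wsrc C p = wrng C q" using 9 src_rng_word_groupoid by simp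
    with pq show ?case using app S(2,4) by simp
  next
    case (10 a b)
    then obtain p q where pq: "word C p" "word C q" "a = wcls C p" "b = wcls C q"
      using S(1) by metis
    hence "wsrc C p = wrng C q" using 10 src_rng_word_groupoid by simp
    with pq show ?case using app S(3,4) by simp
  next
    case (11 a b c)
    then obtain p q r where pqr: "word C p" "word C q" "word C r"
      "a = wcls C p" "b = wcls C q" "c = wcls C r" using S(1) by metis
    moreover have "wsrc C p = wrng C q" "wsrc C q = wrng C r"
      using 11 pqr src_rng_word_groupoid by auto
    ultimately show ?case using app by (simp add: S)
  next
    case (12 a)
    then obtain p where p: "word C p" "a = wcls C p" using S(1) by metis
    have "wcls C (p @ [(wsrc C p, True)]) = wcls C p"
      using weq_unit_right[OF p(1)] weq_word wcls_eq by metis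
    thus ?case using p ws[OF p(1)] by (simp add: S)
  next
    case (13 a)
    then obtain p where p: "word C p" "a = wcls C p" using S(1) by metis
    have "wcls C ((wrng C p, True) # p) = wcls C p"
      using weq_unit_left[OF p(1)] weq_word wcls_eq by metis
    thus ?case using p wr[OF p(1)] S(4)[of "[(wrng C p, True)]" p] by (simp add: S)
  next
    case (14 a)
    then obtain p where p: "word C p" "a = wcls C p" using S(1) by metis
    note i = winv_word[OF p(1)]
    have "wcls C (p @ winv p) = wcls C [(wrng C p, True)]"
      using weq_winv[OF p(1)] weq_word wcls_eq by metis
    moreover have "wcls C (winv p @ p) = wcls C [(wsrc C p, True)]"
      using weq_winv[of "winv p"] i weq_word wcls_eq winv_winv by metis
    ultimately show ?case
      using p i S(1) by (intro bexI[of _ "wcls C (winv p)"]) (auto simp: S)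
  qed
qed

lemma is_functor_word_incl:
  assumes "small_category C"
  shows "is_functor C (word_groupoid C) (word_incl C)"
proof -
  interpret small_category C by fact
  note S = word_groupoid_simps[OF assms]
  have w: "word C [(a, True)]" "wrng C [(a, True)] = rng C a" "wsrc C [(a, True)] = src C a"
    if "a \<in> Mor C" for a
    using that by (auto simp: wrng_def wsrc_def lrng_def lsrc_def)
  have "wcls C [(cmp C a b, True)] = wcls C ([(a, True)] @ [(b, True)])"
    if "a \<in> Mor C" "b \<in> Mor C" "src C a = rng C b" for a b
  proof -
    have "weq C [(a, True), (b, True)] [(cmp C a b, True)]"
      using weq_step[OF wstep.intros(1)[OF that], of "[]" "[]"] that
      by (simp add: lsrc_def lrng_def)
    thus ?thesis using wcls_eq weq_word by (metis append_Cons append_Nil)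
  qed
  moreover have "wcls C [(a, True)] \<in> Mor (word_groupoid C)" if "a \<in> Mor C" for a
    using w(1)[OF that] S(1) by blast
  ultimately show ?thesis
    using w S(2-4) by (auto simp: is_functor_def word_incl_def)
qed

context
  fixes C :: "'c scat" and K :: "'k scat" and F
  assumes C: "small_category C" and K: "groupoid K" and F: "is_functor C K F"
begin

interpretation C: small_category C by (rule C)
interpretation K: groupoid K by (rule K)

lemma letter_ev:
  assumes "fst l \<in> Mor C"
  shows "letter_ev K F l \<in> Mor K" "rng K (letter_ev K F l) = F (lrng C l)"
    "src K (letter_ev K F l) = F (lsrc C l)"
  using assms F K.ginv[of "F (fst l)"]
  by (auto simp: letter_ev_def lrng_def lsrc_def is_functor_def)

lemma word_ev:
  "word C p \<Longrightarrow> word_ev K F p \<in> Mor K \<and> rng K (word_ev K F p) = F (wrng C p) \<and>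
    src K (word_ev K F p) = F (wsrc C p)"
proof (induction p)
  case (Cons l p)
  show ?case
  proof (cases "p = []")
    case True
    thus ?thesis using Cons.prems letter_ev[of l] by (simp add: wrng_def wsrc_def)
  next
    case False
    have l: "fst l \<in> Mor C" using Cons.prems by (simp add: word_Cons)
    show ?thesis
      using Cons False letter_ev[OF l]
      by (auto simp: word_ev_Cons word_Cons K.cmp_closed K.src_cmp K.rng_cmp) (auto simp: wrng_def wsrc_def)
  qed
qed simp

lemma word_ev_append:
  "word C p \<Longrightarrow> word C q \<Longrightarrow> wsrc C p = wrng C q \<Longrightarrow>
    word_ev K F (p @ q) = cmp K (word_ev K F p) (word_ev K F q)"
proof (induction p)
  case (Cons l p)
  have q: "q \<noteq> []" using Cons.prems word_nonempty by blast
  show ?case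
  proof (cases "p = []")
    case True
    thus ?thesis using q by (simp add: word_ev_Cons)
  next
    case False
    hence p: "word C p" "fst l \<in> Mor C" "lsrc C l = wrng C p" "wsrc C p = wrng C q"
      using Cons.prems by (auto simp: word_Cons wsrc_def)
    have "cmp K (cmp K (letter_ev K F l) (word_ev K F p)) (word_ev K F q) =
        cmp K (letter_ev K F l) (cmp K (word_ev K F p) (word_ev K F q))"
      using letter_ev[OF p(2)] word_ev[OF p(1)] word_ev[OF Cons.prems(2)] p
      by (intro K.cmp_assoc) auto
    thus ?thesis using Cons.IH p Cons.prems False by (simp add: word_ev_Cons)
  qed
qed simp

lemma wstep_ev: "wstep C p q \<Longrightarrow> word_ev K F p = word_ev K F q"
proof (induction rule: wstep.induct)
  case (1 a b)
  thus ?case using F by (simp add: letter_ev_def is_functor_def)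
next
  case (4 a)
  thus ?case using F K.ginv[of "F a"] K.cmp_rng[of "ginv K (F a)"]
    by (simp add: letter_ev_def is_functor_def)
next
  case (5 a)
  thus ?case using F K.ginv[of "F a"] K.cmp_src[of "ginv K (F a)"]
    by (simp add: letter_ev_def is_functor_def)
qed (use F K.ginv in \<open>auto simp: letter_ev_def is_functor_def\<close>)

lemma weq_ev: "weq C p q \<Longrightarrow> word_ev K F p = word_ev K F q"
proof (induction rule: weq.induct)
  case (weq_step p q u v)
  note s = C.wstep_word[OF weq_step(1)]
  hence ne: "p \<noteq> []" "q \<noteq> []" using word_nonempty by blast+
  have e: "word_ev K F p = word_ev K F q" by (rule wstep_ev[OF weq_step(1)])
  have pv: "word_ev K F (p @ v) = word_ev K F (q @ v) \<and> word C (p @ v) \<and> word C (q @ v)"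
  proof (cases "v = []")
    case False
    hence "word C v" "wsrc C p = wrng C v"
      using weq_step(2) ne by (cases "u = []"; auto simp: word_append)+
    thus ?thesis using s e word_ev_append ne False by (auto simp: word_append)
  qed (use e s in auto)
  show ?case
  proof (cases "u = []")
    case False
    hence u: "word C u" "wsrc C u = wrng C p" using weq_step(2) ne
      by (auto simp: word_append)
    thus ?thesis using pv s ne word_ev_append by auto
  qed (use pv in auto)
qed auto

lemma word_groupoid_universal:
  "\<exists>!f. f \<in> extensional (Mor (word_groupoid C)) \<and> is_functor (word_groupoid C) K f \<and>
    (\<forall>a \<in> Mor C. f (word_incl C a) = F a)"
proof -
  let ?W = "word_groupoid C"
  note S = word_groupoid_simps[OF C]
  define f where "f = restrict (\<lambda>X. word_ev K F (rep X)) (Mor ?W)"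
  have f: "f (wcls C p) = word_ev K F p" if "word C p" for p
    using that weq_ev[OF C.rep_wcls[OF that]] by (auto simp: f_def S)
  have ext: "f \<in> extensional (Mor ?W)" by (simp add: f_def)
  have fun_f: "is_functor ?W K f"
    unfolding is_functor_def
  proof (intro conjI ballI impI)
    fix X assume "X \<in> Mor ?W"
    then obtain p where p: "word C p" "X = wcls C p" using S(1) by metis
    show "f X \<in> Mor K" "f (src ?W X) = src K (f X)" "f (rng ?W X) = rng K (f X)"
      using p word_ev[OF p(1)] C.wsrc_closed[OF p(1)] C.wrng_closed[OF p(1)]
      by (auto simp: S f letter_ev_def)
  next
    fix X Y assume "X \<in> Mor ?W" "Y \<in> Mor ?W" and c: "src ?W X = rng ?W Y"
    then obtain p q where p: "word C p" "X = wcls C p" and q: "word C q" "Y = wcls C q"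
      using S(1) by metis
    have pq: "wsrc C p = wrng C q" using c p q C.src_rng_word_groupoid by simp
    hence "word C (p @ q)" using p q word_appendI by blast
    thus "f (cmp ?W X Y) = cmp K (f X) (f Y)"
      using p q pq word_ev_append by (simp add: S f)
  qed
  have fi: "\<forall>a \<in> Mor C. f (word_incl C a) = F a"
    by (simp add: word_incl_def f letter_ev_def)
  have uniq: "g = f" if g: "g \<in> extensional (Mor ?W)" "is_functor ?W K g"
      "\<forall>a \<in> Mor C. g (word_incl C a) = F a" for g
  proof (rule extensionalityI[OF g(1) ext])
    fix X assume "X \<in> Mor ?W"
    then obtain p where p: "word C p" "X = wcls C p" using S(1) by metis
    have l: "g (wcls C [l]) = letter_ev K F l" if "fst l \<in> Mor C" for l
    proof -
      obtain a b where l: "l = (a, b)" by fastforce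
      have a: "a \<in> Mor C" using that l by simp
      have pos: "g (wcls C [(a, True)]) = F a" using g(3) a by (simp add: word_incl_def)
      have neg: "wcls C [(a, False)] = ginv ?W (wcls C [(a, True)])"
      proof (rule groupoid.inv_unique[OF groupoid_word_groupoid[OF C]])
        have w: "word C [(a, True)]" "word C [(a, False)]" using a by auto
        show "wcls C [(a, True)] \<in> Mor ?W" "wcls C [(a, False)] \<in> Mor ?W"
          using w S(1) by blast+
        have e: "wrng C [(a, True)] = rng C a" "wsrc C [(a, True)] = src C a"
          "wrng C [(a, False)] = src C a" "wsrc C [(a, False)] = rng C a"
          by (auto simp: wrng_def wsrc_def lrng_def lsrc_def)
        show "src ?W (wcls C [(a, False)]) = rng ?W (wcls C [(a, True)])"
          "rng ?W (wcls C [(a, False)]) = src ?W (wcls C [(a, True)])"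
          using w e by (auto simp: S)
        have "weq C [(a, False), (a, True)] [(src C a, True)]"
          using weq_step[OF wstep.intros(2)[OF a], of "[]" "[]"] a
          by (simp add: lsrc_def lrng_def)
        hence "wcls C [(a, False), (a, True)] = wcls C [(src C a, True)]"
          using C.wcls_eq C.weq_word by metis
        thus "cmp ?W (wcls C [(a, False)]) (wcls C [(a, True)]) = src ?W (wcls C [(a, True)])"
          using w e by (simp add: S)
      qed
      have "word C [(a, True)]" using a by simp
      hence "wcls C [(a, True)] \<in> Mor ?W" using S(1) by blast
      from functor_ginv[OF groupoid_word_groupoid[OF C] K g(2) this]
      show ?thesis using pos neg l by (simp add: letter_ev_def)
    qed
    have "g (wcls C p) = word_ev K F p" using p(1)
    proof (induction p)
      case (Cons m p)
      have m: "fst m \<in> Mor C" using Cons.prems by (simp add: word_Cons)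
      show ?case
      proof (cases "p = []")
        case True
        thus ?thesis using l[OF m] by simp
      next
        case False
        hence p: "word C p" "wsrc C [m] = wrng C p" using Cons.prems by (auto simp: word_Cons wsrc_def)
        have w: "word C [m]" using m by simp
        have c: "cmp ?W (wcls C [m]) (wcls C p) = wcls C (m # p)"
          using S(4)[OF w p] by simp
        have "g (cmp ?W (wcls C [m]) (wcls C p)) = cmp K (g (wcls C [m])) (g (wcls C p))"
          using g(2) S(1) w p C.src_rng_word_groupoid[OF w p(1)] unfolding is_functor_def by blast
        thus ?thesis using l[OF m] Cons.IH[OF p(1)] False c by (simp add: word_ev_Cons)
      qed
    qed simp
    thus "g X = f X" using p f by simp
  qed
  show ?thesis using ext fun_f fi uniq by blast
qed

end

lemma universal_at_word_groupoid:
  "small_category C \<Longrightarrow> universal_at TYPE('k) C (word_groupoid C) (word_incl C)"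
  unfolding universal_at_def using word_groupoid_universal by blast

theorem fundamental_groupoid_exists:
  "small_category C \<Longrightarrow> fundamental_groupoid C (word_groupoid C) (word_incl C)"
  unfolding fundamental_groupoid_def
  by (simp add: groupoid_word_groupoid is_functor_word_incl universal_at_word_groupoid)

theorem fundamental_groupoid_universal:
  fixes C :: "'c scat" and H :: "'h scat"
  assumes C: "small_category C" and H: "fundamental_groupoid C H i"
  shows "universal_at TYPE('k) C H i"
  unfolding universal_at_def
proof (intro allI impI)
  fix K :: "'k scat" and F assume KF: "groupoid K \<and> is_functor C K F"
  let ?W = "word_groupoid C" and ?j = "word_incl C"
  have gH: "groupoid H" and i: "is_functor C H i"
    and uH: "universal_at TYPE('h) C H i" and uW: "universal_at TYPE(('c \<times> bool) list set) C H i"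
    using H by (auto simp: fundamental_groupoid_def)
  interpret H: groupoid H by (rule gH)
  interpret C: small_category C by (rule C)
  have gW: "groupoid ?W" and j: "is_functor C ?W ?j"
    using C by (simp_all add: groupoid_word_groupoid is_functor_word_incl)
  obtain s where s: "is_functor H ?W s" "\<forall>a \<in> Mor C. s (i a) = ?j a"
    using ex1_implies_ex[OF uW[unfolded universal_at_def, rule_format, OF conjI[OF gW j]]] by blast
  obtain t where t: "is_functor ?W H t" "\<forall>a \<in> Mor C. t (?j a) = i a"
    using ex1_implies_ex[OF word_groupoid_universal[OF C gH i]] by blast
  have ts: "t (s x) = x" if x: "x \<in> Mor H" for x
  proof -
    let ?p = "restrict (\<lambda>x. t (s x)) (Mor H)" and ?q = "restrict (\<lambda>x. x) (Mor H)"
    have iM: "i a \<in> Mor H" if "a \<in> Mor C" for a using i that by (simp add: is_functor_def)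
    have restr: "is_functor H H (restrict f (Mor H))" if "is_functor H H f" for f
      using that unfolding is_functor_def
      by (auto simp: H.src_closed H.rng_closed H.cmp_closed)
    have "is_functor H H (\<lambda>x. x)" by (simp add: is_functor_def)
    hence "is_functor H H ?p" "is_functor H H ?q"
      using restr is_functor_comp[OF s(1) t(1)] by blast+
    moreover have "\<forall>a \<in> Mor C. ?p (i a) = i a" "\<forall>a \<in> Mor C. ?q (i a) = i a"
      using s(2) t(2) iM by auto
    moreover have "?p \<in> extensional (Mor H)" "?q \<in> extensional (Mor H)" by simp_all
    ultimately have "?p = ?q"
      using ex1_implies_ex uH[unfolded universal_at_def, rule_format, OF conjI[OF gH i]] by metis
    thus ?thesis using x by (metis restrict_apply')
  qed
  obtain f where f: "is_functor ?W K f" "\<forall>a \<in> Mor C. f (?j a) = F a"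
    "\<And>g. g \<in> extensional (Mor ?W) \<and> is_functor ?W K g \<and> (\<forall>a \<in> Mor C. g (?j a) = F a) \<Longrightarrow> g = f"
    using word_groupoid_universal[OF C KF[THEN conjunct1] KF[THEN conjunct2]]
    unfolding Ex1_def by metis
  define h where "h = restrict (\<lambda>x. f (s x)) (Mor H)"
  show "\<exists>!h. h \<in> extensional (Mor H) \<and> is_functor H K h \<and> (\<forall>a \<in> Mor C. h (i a) = F a)"
  proof (rule ex1I[of _ h])
    have "is_functor H K h"
      using is_functor_comp[OF s(1) f(1)] unfolding h_def is_functor_def
      by (simp add: H.src_closed H.rng_closed H.cmp_closed)
    moreover have "h (i a) = F a" if "a \<in> Mor C" for a
      using that i s(2) f(2) by (simp add: h_def is_functor_def)
    ultimately show "h \<in> extensional (Mor H) \<and> is_functor H K h \<and> (\<forall>a \<in> Mor C. h (i a) = F a)"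
      by (simp add: h_def)
  next
    fix g assume g: "g \<in> extensional (Mor H) \<and> is_functor H K g \<and> (\<forall>a \<in> Mor C. g (i a) = F a)"
    let ?g = "restrict (\<lambda>X. g (t X)) (Mor ?W)"
    interpret W: groupoid ?W by (rule gW)
    have "is_functor ?W K (\<lambda>X. g (t X))" using is_functor_comp t(1) g by blast
    hence "is_functor ?W K ?g"
      unfolding is_functor_def by (auto simp: W.src_closed W.rng_closed W.cmp_closed)
    moreover have "\<forall>a \<in> Mor C. ?g (?j a) = F a"
      using t(2) g j by (auto simp: is_functor_def)
    ultimately have "?g = f" using f(3)[of ?g] by simp
    show "g = h"
    proof (rule extensionalityI[of _ "Mor H"])
      fix x assume x: "x \<in> Mor H"
      have "s x \<in> Mor ?W" using s(1) x by (simp add: is_functor_def)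
      hence "f (s x) = g (t (s x))" using \<open>?g = f\<close> by (metis restrict_apply')
      thus "g x = h x" using ts[OF x] x by (simp add: h_def)
    qed (use g in \<open>auto simp: h_def\<close>)
  qed
qed

end

theory Submission
  imports Defs
begin

text \<open>
  Write \<open>v \<sim> w\<close> for the equivalence relation generated by the morphisms of the skew product. The
  point is that a morphism \<open>h\<close> of the fundamental groupoid from \<open>y\<close> to \<open>x\<close> with \<open>\<psi> h = g\<close> exists
  if and only if \<open>(x, g \<otimes> k) \<sim> (y, k)\<close> for every \<open>k\<close>, equivalently for some \<open>k\<close>.

  From right to left, \<open>i \<times> id\<close> is a functor from the skew product of \<open>C\<close> to the skew product of
  the fundamental groupoid, and the latter is itself a groupoid. A functor into a groupoid sends
  equivalent objects to isomorphic ones (\<open>linked_imp_homset_nonempty\<close>), and an isomorphism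
  \<open>(y, k) \<rightarrow> (x, g \<otimes> k)\<close> in the second skew product is a morphism \<open>h\<close> with \<open>\<psi> h = g\<close>.

  From left to right, the triples \<open>(x, g, y)\<close> with \<open>(x, g \<otimes> k) \<sim> (y, k)\<close> for every \<open>k\<close> form a
  groupoid, and \<open>a \<mapsto> (r a, \<eta> a, s a)\<close> is a functor from \<open>C\<close> to it. The universal property extends
  this functor to the fundamental groupoid. The middle component of the extension is a cocycle that
  restricts to \<open>\<eta>\<close>, so it is \<open>\<psi>\<close>, and every \<open>h\<close> from \<open>y\<close> to \<open>x\<close> is sent to \<open>(x, \<psi> h, y)\<close>
  (\<open>homset_imp_linked\<close>).

  Hence the skew product is connected precisely when \<open>\<psi>\<close> maps every set of morphisms between two
  objects, and not only every fundamental group, onto \<open>G\<close>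
  (\<open>connected_skew_product_iff\<close>). As \<open>C\<close> is connected, so is its fundamental groupoid, and
  multiplying by fixed connecting morphisms on both sides, which translates the image under \<open>\<psi>\<close> in
  \<open>G\<close>, carries surjectivity from one fundamental group to all these sets.
\<close>

section \<open>Linked objects\<close>

definition linked :: "'a scat \<Rightarrow> 'a \<Rightarrow> 'a \<Rightarrow> bool" where
  "linked C = equivclp (\<lambda>x y. x \<in> Obj C \<and> y \<in> Obj C \<and> homset C x y \<noteq> {})"

lemma connected_category_linked:
  "connected_category C \<longleftrightarrow> (\<forall>v \<in> Obj C. \<forall>w \<in> Obj C. linked C v w)"
  by (simp add: connected_category_def linked_def)

lemma linked_refl: "linked C v v"
  by (simp add: linked_def)

lemma linked_sym: "linked C v w \<Longrightarrow> linked C w v"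
  unfolding linked_def by (rule equivclp_sym)

lemma linked_trans: "linked C u v \<Longrightarrow> linked C v w \<Longrightarrow> linked C u w"
  unfolding linked_def by (rule equivclp_trans)

lemma (in small_category) src_in_Obj: "a \<in> Mor C \<Longrightarrow> src C a \<in> Obj C"
  by (simp add: Obj_def src_closed src_src)

lemma (in small_category) rng_in_Obj: "a \<in> Mor C \<Longrightarrow> rng C a \<in> Obj C"
  by (simp add: Obj_def rng_closed src_rng)

lemma (in small_category) rng_Obj: "v \<in> Obj C \<Longrightarrow> rng C v = v"
  using rng_src[of v] by (simp add: Obj_def)

lemma (in small_category) linked_rng_src:
  assumes "a \<in> Mor C"
  shows "linked C (rng C a) (src C a)"
  unfolding linked_def
  by (rule r_into_equivclp) (use assms src_in_Obj rng_in_Obj in \<open>auto simp: homset_def\<close>)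

lemma is_functor_homset:
  "is_functor C D F \<Longrightarrow> a \<in> homset C v w \<Longrightarrow> F a \<in> homset D (F v) (F w)"
  unfolding is_functor_def homset_def by auto

lemma (in small_category) homset_cmp:
  "a \<in> homset C u v \<Longrightarrow> b \<in> homset C v w \<Longrightarrow> cmp C a b \<in> homset C u w"
  unfolding homset_def by (auto simp: cmp_closed src_cmp rng_cmp)

lemma (in groupoid) homset_ginv: "a \<in> homset C v w \<Longrightarrow> ginv C a \<in> homset C w v"
  unfolding homset_def by (auto simp: ginv)

text \<open>
  In a groupoid, having a morphism between them is already an equivalence relation on the objects.
\<close>

lemma linked_imp_homset_nonempty:
  assumes "small_category C" "groupoid K" "is_functor C K F"
    and "linked C v w" and v: "v \<in> Obj C"
  shows "homset K (F v) (F w) \<noteq> {}"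
  using assms(4) unfolding linked_def
proof (induction rule: equivclp_induct)
  case base
  interpret C: small_category C by fact
  have "v \<in> homset C v v" using v C.rng_Obj[OF v] by (simp add: homset_def Obj_def)
  thus ?case using is_functor_homset[OF assms(3)] by blast
next
  case (step y z)
  interpret K: groupoid K by fact
  have "homset K (F y) (F z) \<noteq> {}"
    using step(2) is_functor_homset[OF assms(3)] K.homset_ginv by blast
  thus ?case using step.IH K.homset_cmp by blast
qed

section \<open>Skew products\<close>

lemma cocycleD:
  assumes "cocycle C G \<eta>"
  shows "a \<in> Mor C \<Longrightarrow> \<eta> a \<in> carrier G" "a \<in> Mor C \<Longrightarrow> \<eta> (src C a) = \<one>\<^bsub>G\<^esub>"
    "a \<in> Mor C \<Longrightarrow> \<eta> (rng C a) = \<one>\<^bsub>G\<^esub>"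
    "a \<in> Mor C \<Longrightarrow> b \<in> Mor C \<Longrightarrow> src C a = rng C b \<Longrightarrow> \<eta> (cmp C a b) = \<eta> a \<otimes>\<^bsub>G\<^esub> \<eta> b"
  using assms by (auto simp: cocycle_def is_functor_def group_cat_def)

lemma Obj_skew_product: "Obj (skew_product C G \<eta>) = Obj C \<times> carrier G"
  by (auto simp: Obj_def skew_product_def)

lemma homset_skew_product:
  "(a, k') \<in> homset (skew_product C G \<eta>) (v, g) (w, k) \<longleftrightarrow>
    a \<in> homset C v w \<and> \<eta> a \<otimes>\<^bsub>G\<^esub> k = g \<and> k' = k \<and> k \<in> carrier G"
  by (auto simp: homset_def skew_product_def)

lemma small_category_skew_product:
  assumes "small_category C" "group G" "cocycle C G \<eta>"
  shows "small_category (skew_product C G \<eta>)"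
proof -
  interpret C: small_category C by fact
  interpret G: group G by fact
  note e = cocycleD[OF assms(3)]
  show ?thesis
    unfolding small_category_def skew_product_def
    using C.nonempty G.one_closed
    by (auto simp: e C.src_closed C.rng_closed C.src_src C.rng_src C.src_rng C.rng_rng C.cmp_closed
      C.src_cmp C.rng_cmp C.cmp_assoc C.cmp_src C.cmp_rng G.m_assoc)
qed

lemma groupoid_skew_product:
  assumes "groupoid H" "group G" "cocycle H G \<psi>"
  shows "groupoid (skew_product H G \<psi>)"
proof -
  interpret H: groupoid H by fact
  interpret G: group G by fact
  note e = cocycleD[OF assms(3)]
  show ?thesis
    unfolding groupoid_def groupoid_axioms_def
  proof (intro conjI allI impI)
    show "small_category (skew_product H G \<psi>)"
      by (rule small_category_skew_product[OF H.small_category_axioms assms(2,3)])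
    fix x assume "x \<in> Mor (skew_product H G \<psi>)"
    then obtain a g where x: "x = (a, g)" "a \<in> Mor H" "g \<in> carrier G"
      by (auto simp: skew_product_def)
    have "\<psi> (ginv H a) \<otimes>\<^bsub>G\<^esub> \<psi> a = \<one>\<^bsub>G\<^esub>"
      using e(4)[of "ginv H a" a] e(2)[of a] x H.ginv[of a] by simp
    hence "\<psi> (ginv H a) \<otimes>\<^bsub>G\<^esub> (\<psi> a \<otimes>\<^bsub>G\<^esub> g) = g"
      using x e(1) H.ginv[of a] by (simp add: G.m_assoc[symmetric])
    thus "\<exists>b \<in> Mor (skew_product H G \<psi>).
        src (skew_product H G \<psi>) b = rng (skew_product H G \<psi>) x \<and>
        rng (skew_product H G \<psi>) b = src (skew_product H G \<psi>) x \<and>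
        cmp (skew_product H G \<psi>) x b = rng (skew_product H G \<psi>) x \<and>
        cmp (skew_product H G \<psi>) b x = src (skew_product H G \<psi>) x"
      using x e(1) H.ginv[of a]
      by (intro bexI[of _ "(ginv H a, \<psi> a \<otimes>\<^bsub>G\<^esub> g)"]) (auto simp: skew_product_def)
  qed
qed

lemma is_functor_skew_product:
  assumes "is_functor C H i" "\<forall>a \<in> Mor C. \<eta> a = \<psi> (i a)"
  shows "is_functor (skew_product C G \<eta>) (skew_product H G \<psi>) (\<lambda>(a, g). (i a, g))"
  using assms unfolding is_functor_def skew_product_def by auto

section \<open>From linked objects of the skew product to morphisms and back\<close>

lemma linked_imp_homset:
  assumes "small_category C" "group G" "cocycle C G \<eta>"
    and "groupoid H" "is_functor C H i" "associated_cocycle C G \<eta> H i \<psi>"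
    and "linked (skew_product C G \<eta>) (x, g) (y, k)" "x \<in> Obj C" "g \<in> carrier G"
  shows "\<exists>h \<in> homset H (i x) (i y). \<psi> h \<otimes>\<^bsub>G\<^esub> k = g"
proof -
  have a: "cocycle H G \<psi>" "\<forall>a \<in> Mor C. \<eta> a = \<psi> (i a)"
    using assms(6) by (auto simp: associated_cocycle_def)
  have "homset (skew_product H G \<psi>) (i x, g) (i y, k) \<noteq> {}"
    using linked_imp_homset_nonempty[OF small_category_skew_product[OF assms(1-3)]
        groupoid_skew_product[OF assms(4,2) a(1)] is_functor_skew_product[OF assms(5) a(2)] assms(7)]
      assms(8,9) by (simp add: Obj_skew_product)
  then obtain h k' where "(h, k') \<in> homset (skew_product H G \<psi>) (i x, g) (i y, k)" by fast
  thus ?thesis unfolding homset_skew_product by blast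
qed

text \<open>
  Demanding the link for every \<open>k\<close> builds in invariance under right translation by \<open>G\<close>, which is what
  makes these triples closed under composition and inversion.
\<close>

definition link_groupoid :: "'a scat \<Rightarrow> ('g, 'm) monoid_scheme \<Rightarrow> ('a \<Rightarrow> 'g) \<Rightarrow> ('a \<times> 'g \<times> 'a) scat" where
  "link_groupoid C G \<eta> =
    \<lparr>Mor = {(v, g, w). v \<in> Obj C \<and> g \<in> carrier G \<and> w \<in> Obj C \<and>
       (\<forall>k \<in> carrier G. linked (skew_product C G \<eta>) (v, g \<otimes>\<^bsub>G\<^esub> k) (w, k))},
     src = (\<lambda>(v, g, w). (w, \<one>\<^bsub>G\<^esub>, w)),
     rng = (\<lambda>(v, g, w). (v, \<one>\<^bsub>G\<^esub>, v)),
     cmp = (\<lambda>(v, g, w) (v', g', w'). (v, g \<otimes>\<^bsub>G\<^esub> g', w'))\<rparr>"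

lemma groupoid_link_groupoid:
  assumes "small_category C" "group G"
  shows "groupoid (link_groupoid C G \<eta>)"
proof -
  interpret C: small_category C by fact
  interpret G: group G by fact
  let ?K = "link_groupoid C G \<eta>"
  let ?L = "linked (skew_product C G \<eta>)"
  have comp: "?L (u, (g \<otimes>\<^bsub>G\<^esub> h) \<otimes>\<^bsub>G\<^esub> k) (w, k)"
    if "\<forall>k \<in> carrier G. ?L (u, g \<otimes>\<^bsub>G\<^esub> k) (v, k)" "\<forall>k \<in> carrier G. ?L (v, h \<otimes>\<^bsub>G\<^esub> k) (w, k)"
      "g \<in> carrier G" "h \<in> carrier G" "k \<in> carrier G" for u v w g h k
    using that linked_trans[of "skew_product C G \<eta>" "(u, g \<otimes>\<^bsub>G\<^esub> (h \<otimes>\<^bsub>G\<^esub> k))" "(v, h \<otimes>\<^bsub>G\<^esub> k)" "(w, k)"]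
    by (simp add: G.m_assoc)
  obtain a where "a \<in> Mor C" using C.nonempty by blast
  hence "(src C a, \<one>\<^bsub>G\<^esub>, src C a) \<in> Mor ?K"
    by (simp add: link_groupoid_def C.src_in_Obj linked_refl)
  hence ne: "Mor ?K \<noteq> {}" by blast
  have "small_category ?K"
    unfolding small_category_def
    using ne comp by (auto simp: link_groupoid_def linked_refl G.m_assoc)
  moreover have "\<exists>b \<in> Mor ?K. src ?K b = rng ?K x \<and> rng ?K b = src ?K x \<and>
      cmp ?K x b = rng ?K x \<and> cmp ?K b x = src ?K x" if xK: "x \<in> Mor ?K" for x
  proof -
    obtain v g w where x: "x = (v, g, w)" "v \<in> Obj C" "g \<in> carrier G" "w \<in> Obj C"
      "\<forall>k \<in> carrier G. ?L (v, g \<otimes>\<^bsub>G\<^esub> k) (w, k)"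
      using xK by (auto simp: link_groupoid_def)
    have "?L (w, inv\<^bsub>G\<^esub> g \<otimes>\<^bsub>G\<^esub> k) (v, k)" if k: "k \<in> carrier G" for k
    proof -
      have "?L (v, g \<otimes>\<^bsub>G\<^esub> (inv\<^bsub>G\<^esub> g \<otimes>\<^bsub>G\<^esub> k)) (w, inv\<^bsub>G\<^esub> g \<otimes>\<^bsub>G\<^esub> k)" using x k by blast
      thus ?thesis using x(3) k linked_sym by (simp add: G.m_assoc[symmetric])
    qed
    thus ?thesis using x
      by (intro bexI[of _ "(w, inv\<^bsub>G\<^esub> g, v)"]) (auto simp: link_groupoid_def)
  qed
  ultimately show ?thesis by (simp add: groupoid_def groupoid_axioms_def)
qed

lemma is_functor_link_groupoid:
  assumes "small_category C" "group G" "cocycle C G \<eta>"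
  shows "is_functor C (link_groupoid C G \<eta>) (\<lambda>a. (rng C a, \<eta> a, src C a))"
proof -
  interpret C: small_category C by fact
  interpret S: small_category "skew_product C G \<eta>" by (rule small_category_skew_product[OF assms])
  note e = cocycleD[OF assms(3)]
  have "linked (skew_product C G \<eta>) (rng C a, \<eta> a \<otimes>\<^bsub>G\<^esub> k) (src C a, k)"
    if "a \<in> Mor C" "k \<in> carrier G" for a k
    using S.linked_rng_src[of "(a, k)"] that by (simp add: skew_product_def)
  thus ?thesis
    unfolding is_functor_def
    by (auto simp: link_groupoid_def e C.src_in_Obj C.rng_in_Obj C.src_src C.rng_src C.src_rng C.rng_rng
      C.src_cmp C.rng_cmp)
qed

lemma groupoid_group_cat:
  assumes "group G"
  shows "groupoid (group_cat G)"
proof -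
  interpret G: group G by fact
  have "\<exists>b \<in> carrier G. a \<otimes>\<^bsub>G\<^esub> b = \<one>\<^bsub>G\<^esub> \<and> b \<otimes>\<^bsub>G\<^esub> a = \<one>\<^bsub>G\<^esub>" if "a \<in> carrier G" for a
    using that by (intro bexI[of _ "inv\<^bsub>G\<^esub> a"]) auto
  thus ?thesis
    using G.one_closed
    unfolding groupoid_def groupoid_axioms_def small_category_def group_cat_def
    by (auto simp: G.m_assoc)
qed

lemma fundamental_groupoid_functor_eqI:
  assumes C: "small_category C" "fundamental_groupoid C H i" and K: "groupoid K"
    and f: "is_functor H K f" and g: "is_functor H K g"
    and eq: "\<And>a. a \<in> Mor C \<Longrightarrow> f (i a) = g (i a)" and h: "h \<in> Mor H"
  shows "f h = g h"
proof -
  have gH: "groupoid H" and i: "is_functor C H i" using C(2) by (auto simp: fundamental_groupoid_def)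
  interpret H: groupoid H by (rule gH)
  have restr: "is_functor H K (restrict u (Mor H))" if "is_functor H K u" for u
    using that unfolding is_functor_def by (auto simp: H.src_closed H.rng_closed H.cmp_closed)
  have iM: "i a \<in> Mor H" if "a \<in> Mor C" for a using i that by (simp add: is_functor_def)
  have "is_functor C K (\<lambda>a. f (i a))" by (rule is_functor_comp[OF i f])
  hence "\<exists>!u. u \<in> extensional (Mor H) \<and> is_functor H K u \<and> (\<forall>a \<in> Mor C. u (i a) = f (i a))"
    using fundamental_groupoid_universal[OF C] K unfolding universal_at_def by blast
  moreover have "\<forall>a \<in> Mor C. restrict f (Mor H) (i a) = f (i a)"
    "\<forall>a \<in> Mor C. restrict g (Mor H) (i a) = f (i a)" using iM eq by auto
  ultimately have "restrict f (Mor H) = restrict g (Mor H)"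
    using restr[OF f] restr[OF g] restrict_extensional by blast
  thus ?thesis using h by (metis restrict_apply')
qed

text \<open>
  The middle component of the extension of \<open>a \<mapsto> (r a, \<eta> a, s a)\<close> to the fundamental groupoid is
  \<open>\<psi>\<close> by uniqueness, and the outer components are found from the values of the extension at
  objects.
\<close>

lemma homset_imp_linked:
  assumes C: "small_category C" and G: "group G" and \<eta>: "cocycle C G \<eta>"
    and H: "fundamental_groupoid C H i" and \<psi>: "associated_cocycle C G \<eta> H i \<psi>"
    and x: "x \<in> Obj C" and y: "y \<in> Obj C" and h: "h \<in> homset H (i x) (i y)" and k: "k \<in> carrier G"
  shows "linked (skew_product C G \<eta>) (x, \<psi> h \<otimes>\<^bsub>G\<^esub> k) (y, k)"
proof -
  interpret C: small_category C by fact
  let ?K = "link_groupoid C G \<eta>"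
  obtain f where f: "is_functor H ?K f" "\<And>a. a \<in> Mor C \<Longrightarrow> f (i a) = (rng C a, \<eta> a, src C a)"
    using ex1_implies_ex[OF fundamental_groupoid_universal[OF C H, unfolded universal_at_def,
        rule_format, OF conjI[OF groupoid_link_groupoid[OF C G] is_functor_link_groupoid[OF C G \<eta>]]]]
    by blast
  have hM: "h \<in> Mor H" "rng H h = i x" "src H h = i y" using h by (auto simp: homset_def)
  have \<psi>_eq: "fst (snd (f h)) = \<psi> h"
  proof (rule fundamental_groupoid_functor_eqI[OF C H groupoid_group_cat[OF G] _ _ _ hM(1)])
    have "is_functor ?K (group_cat G) (\<lambda>t. fst (snd t))"
      unfolding is_functor_def link_groupoid_def group_cat_def by auto
    thus "is_functor H (group_cat G) (\<lambda>h. fst (snd (f h)))" by (rule is_functor_comp[OF f(1)])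
    show "is_functor H (group_cat G) \<psi>" using \<psi> by (simp add: associated_cocycle_def cocycle_def)
    show "fst (snd (f (i a))) = \<psi> (i a)" if "a \<in> Mor C" for a
      using f(2) \<psi> that by (simp add: associated_cocycle_def)
  qed
  have o: "x \<in> Mor C" "rng C x = x" "y \<in> Mor C" "src C y = y"
    using x y C.rng_Obj by (auto simp: Obj_def)
  have "f h \<in> Mor ?K" "f (i y) = src ?K (f h)" "f (i x) = rng ?K (f h)"
    using f(1) hM unfolding is_functor_def by metis+
  thus ?thesis using \<psi>_eq f(2)[OF o(1)] f(2)[OF o(3)] o k
    by (auto simp: link_groupoid_def)
qed

theorem connected_skew_product_iff:
  assumes C: "small_category C" and G: "group G" and \<eta>: "cocycle C G \<eta>"
    and H: "fundamental_groupoid C H i" and \<psi>: "associated_cocycle C G \<eta> H i \<psi>"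
  shows "connected_category (skew_product C G \<eta>) \<longleftrightarrow>
    (\<forall>x \<in> Obj C. \<forall>y \<in> Obj C. \<psi> ` homset H (i x) (i y) = carrier G)"
proof -
  interpret G: group G by fact
  have gH: "groupoid H" and i: "is_functor C H i" using H by (auto simp: fundamental_groupoid_def)
  have \<psi>_closed: "\<psi> h \<in> carrier G" if "h \<in> homset H v w" for h v w
    using that \<psi> cocycleD(1)[of H G \<psi>] by (auto simp: associated_cocycle_def homset_def)
  show ?thesis
  proof (intro iffI ballI)
    fix x y assume c: "connected_category (skew_product C G \<eta>)" and xy: "x \<in> Obj C" "y \<in> Obj C"
    have "g \<in> \<psi> ` homset H (i x) (i y)" if g: "g \<in> carrier G" for g
    proof -
      have "linked (skew_product C G \<eta>) (x, g) (y, \<one>\<^bsub>G\<^esub>)"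
        using c xy g by (simp add: connected_category_linked Obj_skew_product)
      from linked_imp_homset[OF C G \<eta> gH i \<psi> this xy(1) g]
      show ?thesis using \<psi>_closed by auto
    qed
    thus "\<psi> ` homset H (i x) (i y) = carrier G" using \<psi>_closed by blast
  next
    assume onto: "\<forall>x \<in> Obj C. \<forall>y \<in> Obj C. \<psi> ` homset H (i x) (i y) = carrier G"
    have "linked (skew_product C G \<eta>) (x, g) (y, k)"
      if "x \<in> Obj C" "y \<in> Obj C" "g \<in> carrier G" "k \<in> carrier G" for x y g k
    proof -
      have "g \<otimes>\<^bsub>G\<^esub> inv\<^bsub>G\<^esub> k \<in> \<psi> ` homset H (i x) (i y)" using onto that by simp
      then obtain h where h: "h \<in> homset H (i x) (i y)" "\<psi> h = g \<otimes>\<^bsub>G\<^esub> inv\<^bsub>G\<^esub> k" by force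
      thus ?thesis
        using homset_imp_linked[OF C G \<eta> H \<psi> that(1,2) h(1) that(4)] that(3,4)
        by (simp add: G.m_assoc)
    qed
    thus "connected_category (skew_product C G \<eta>)"
      by (auto simp: connected_category_linked Obj_skew_product)
  qed
qed

section \<open>Independence of the base point\<close>

lemma (in groupoid) cocycle_onto_homset:
  assumes G: "group G" and \<psi>: "cocycle C G \<psi>" and onto: "\<psi> ` homset C x x = carrier G"
    and a: "a \<in> homset C y x" and b: "b \<in> homset C x z"
  shows "\<psi> ` homset C y z = carrier G"
proof -
  interpret G: group G by fact
  note e = cocycleD[OF \<psi>]
  have m: "a \<in> Mor C" "b \<in> Mor C" using a b by (auto simp: homset_def)
  have "g \<in> \<psi> ` homset C y z" if g: "g \<in> carrier G" for g
  proof -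
    \<comment> \<open>The value of \<open>\<psi>\<close> at \<open>h\<close> is chosen so that \<open>a h b\<close> is mapped to \<open>g\<close>.\<close>
    have "inv\<^bsub>G\<^esub> \<psi> a \<otimes>\<^bsub>G\<^esub> g \<otimes>\<^bsub>G\<^esub> inv\<^bsub>G\<^esub> \<psi> b \<in> \<psi> ` homset C x x"
      using onto g e(1) m by simp
    then obtain h where h: "h \<in> homset C x x" "\<psi> h = inv\<^bsub>G\<^esub> \<psi> a \<otimes>\<^bsub>G\<^esub> g \<otimes>\<^bsub>G\<^esub> inv\<^bsub>G\<^esub> \<psi> b" by force
    have hb: "cmp C h b \<in> homset C x z" by (rule homset_cmp[OF h(1) b])
    have "\<psi> (cmp C a (cmp C h b)) = \<psi> a \<otimes>\<^bsub>G\<^esub> (\<psi> h \<otimes>\<^bsub>G\<^esub> \<psi> b)"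
      using e(4) a h(1) b hb by (auto simp: homset_def)
    also have "\<psi> h \<otimes>\<^bsub>G\<^esub> \<psi> b = inv\<^bsub>G\<^esub> \<psi> a \<otimes>\<^bsub>G\<^esub> g"
      using h(2) g e(1) m by (simp add: G.m_assoc)
    also have "\<psi> a \<otimes>\<^bsub>G\<^esub> (inv\<^bsub>G\<^esub> \<psi> a \<otimes>\<^bsub>G\<^esub> g) = g"
      using g e(1) m by (simp add: G.m_assoc[symmetric])
    finally show ?thesis using homset_cmp[OF a hb] by (metis image_eqI)
  qed
  moreover have "\<psi> h \<in> carrier G" if "h \<in> homset C y z" for h
    using that e(1) by (simp add: homset_def)
  ultimately show ?thesis by blast
qed

theorem corollary7p29:
  fixes C :: "'c scat"
    and G :: "('g, 'm) monoid_scheme"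
    and \<eta> :: "'c \<Rightarrow> 'g"
    and H :: "'h scat"
    and i :: "'c \<Rightarrow> 'h"
    and \<psi> :: "'h \<Rightarrow> 'g"
  assumes "small_category C" and "connected_category C"
    and "group G" and "cocycle C G \<eta>" and "nondegenerate C G \<eta>"
    and "fundamental_groupoid C H i"
    and "associated_cocycle C G \<eta> H i \<psi>"
  shows "(connected_category (skew_product C G \<eta>) \<longleftrightarrow>
           (\<forall>x \<in> Obj C. \<psi> ` fundamental_group H i x = carrier G)) \<and>
         ((\<forall>x \<in> Obj C. \<psi> ` fundamental_group H i x = carrier G) \<longleftrightarrow>
           (\<exists>x \<in> Obj C. \<psi> ` fundamental_group H i x = carrier G))"
proof -
  interpret C: small_category C by fact
  have gH: "groupoid H" and i: "is_functor C H i"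
    using assms(6) by (auto simp: fundamental_groupoid_def)
  interpret H: groupoid H by (rule gH)
  have \<psi>: "cocycle H G \<psi>" using assms(7) by (simp add: associated_cocycle_def)
  have conn: "homset H (i x) (i y) \<noteq> {}" if "x \<in> Obj C" "y \<in> Obj C" for x y
    using linked_imp_homset_nonempty[OF assms(1) gH i] assms(2) that
    by (simp add: connected_category_linked)
  have spread: "\<psi> ` homset H (i y) (i z) = carrier G"
    if onto: "\<psi> ` fundamental_group H i x = carrier G"
      and o: "x \<in> Obj C" "y \<in> Obj C" "z \<in> Obj C" for x y z
  proof -
    obtain a b where "a \<in> homset H (i y) (i x)" "b \<in> homset H (i x) (i z)"
      using conn[OF o(2,1)] conn[OF o(1,3)] by blast
    thus ?thesis
      by (rule H.cocycle_onto_homset[OF assms(3) \<psi> onto[unfolded fundamental_group_def]])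
  qed
  have all: "connected_category (skew_product C G \<eta>)"
      "\<forall>x \<in> Obj C. \<psi> ` fundamental_group H i x = carrier G"
    if "x \<in> Obj C" "\<psi> ` fundamental_group H i x = carrier G" for x
    using spread[OF that(2,1)] connected_skew_product_iff[OF assms(1,3,4,6,7)]
    by (simp_all add: fundamental_group_def)
  moreover have "\<forall>x \<in> Obj C. \<psi> ` fundamental_group H i x = carrier G"
    if "connected_category (skew_product C G \<eta>)"
    using that connected_skew_product_iff[OF assms(1,3,4,6,7)] by (simp add: fundamental_group_def)
  moreover obtain x where "x \<in> Obj C" using C.nonempty C.src_in_Obj by blast
  ultimately show ?thesis by meson
qed

end
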